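(* Let $h>0$, let $g:\mathbb{R}_+\to\mathbb{R}_+$ be Lipschitz continuous with constant $L_g>1$, having exactly two fixed points $0$ and $\kappa>0$, and let $c\ge c(L_g)$ and $\lambda_c\in[\lambda_1(c),\lambda_2(c)]$ (see context). If $\phi_1$ and $\phi_2$ are two semi-wavefront profiles with speed $c$ of $$u_t(t,x)=u_{xx}(t,x)-u(t,x)+g(u(t-h,x)),\qquad x\in\mathbb{R},\ t>0,$$ such that the function $z\mapsto e^{-\lambda_c z}|\phi_1(z)-\phi_2(z)|$ belongs to $L^1(\mathbb{R})$, then $\phi_1=\phi_2$.
   Context: $\mathbb{R}_+=[0,\infty)$. A semi-wavefront with speed $c>0$ is a bounded positive solution of the equation of the form $u(t,x)=\psi_c(x+ct)$ whose profile $\psi_c:\mathbb{R}\to\mathbb{R}$ satisfies $\psi_c(-\infty)=0$. For fixed $L>1$ and $c>0$ let $E_c(\lambda)=-\lambda^2+c\lambda+1-Le^{-\lambda ch}$ and $c(L)=\inf\{c>0: E_c(\lambda_0)\ge 0 \text{ for some }\lambda_0\in\mathbb{R}\}$. For $c\ge c(L)$, $\lambda_1(c)\le\lambda_2(c)$ denote the two real solutions (coinciding in the case of a double root) of $E_c(\lambda)=0$; here $L=L_g$. *)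

theory Defs
  imports "HOL-Analysis.Analysis"
begin

text \<open>
  Classical solutions of \<open>u\<^sub>t(t,x) = u\<^sub>x\<^sub>x(t,x) - u(t,x) + g(u(t-h,x))\<close> for \<open>x \<in> \<real>\<close>, \<open>t > 0\<close>.
  The derivatives are only asked to exist; for a travelling wave \<open>u(t,x) = \<psi>(x+ct)\<close> with
  \<open>\<psi> > 0\<close> and \<open>g\<close> continuous on \<open>[0,\<infinity>)\<close>, the equation itself makes them continuous.
\<close>

definition solves_delayed_RD ::
    "real \<Rightarrow> (real \<Rightarrow> real) \<Rightarrow> (real \<Rightarrow> real \<Rightarrow> real) \<Rightarrow> bool" where
  "solves_delayed_RD h g u \<longleftrightarrow>
     (\<exists>ut ux uxx. \<forall>t>0. \<forall>x.
        ((\<lambda>s. u s x) has_real_derivative ut t x) (at t) \<and>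
        ((\<lambda>y. u t y) has_real_derivative ux t x) (at x) \<and>
        ((\<lambda>y. ux t y) has_real_derivative uxx t x) (at x) \<and>
        ut t x = uxx t x - u t x + g (u (t - h) x))"

definition semi_wavefront_profile ::
    "real \<Rightarrow> (real \<Rightarrow> real) \<Rightarrow> real \<Rightarrow> (real \<Rightarrow> real) \<Rightarrow> bool" where
  "semi_wavefront_profile h g c \<psi> \<longleftrightarrow>
     c > 0 \<and>
     bounded (range \<psi>) \<and>
     (\<forall>z. \<psi> z > 0) \<and>
     solves_delayed_RD h g (\<lambda>t x. \<psi> (x + c * t)) \<and>
     (\<psi> \<longlongrightarrow> 0) at_bot"

definition char_E :: "real \<Rightarrow> real \<Rightarrow> real \<Rightarrow> real \<Rightarrow> real" where
  "char_E h L c z = - z\<^sup>2 + c * z + 1 - L * exp (- z * c * h)"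

definition critical_speed :: "real \<Rightarrow> real \<Rightarrow> real" where
  "critical_speed h L = Inf {c. c > 0 \<and> (\<exists>z0. char_E h L c z0 \<ge> 0)}"

text \<open>
  For \<open>L > 1\<close> and \<open>h > 0\<close> the function \<open>char_E h L c\<close> is strictly concave
  and tends to \<open>-\<infinity>\<close> on both sides whenever \<open>c > 0\<close>,
  so for \<open>c \<ge> critical_speed h L\<close> it has two real zeros, or one if that is a double zero;
  \<open>lambda1\<close> and \<open>lambda2\<close> are the smaller and the larger one.
\<close>

definition lambda1 :: "real \<Rightarrow> real \<Rightarrow> real \<Rightarrow> real" where
  "lambda1 h L c = Min {z. char_E h L c z = 0}"

definition lambda2 :: "real \<Rightarrow> real \<Rightarrow> real \<Rightarrow> real" where
  "lambda2 h L c = Max {z. char_E h L c z = 0}"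

end

theory Submission
  imports Defs
begin

text \<open>
  Put \<open>v z = exp (- lam * z) * (\<phi>1 z - \<phi>2 z)\<close>. The profile equations give
  \<open>v'' + (2 * lam - c) * v' = A * v - G\<close> with \<open>A = 1 + c * lam - lam\<^sup>2\<close> and
  \<open>\<bar>G z\<bar> \<le> B * \<bar>v (z - c * h)\<bar>\<close>, where \<open>B = Lg * exp (- lam * c * h)\<close>; by concavity of \<open>char_E\<close>,
  \<open>A - B = char_E h Lg c lam \<ge> 0\<close>. Integrability of \<open>v\<close> and the equation force \<open>v\<close> to vanish
  at both ends, so if \<open>v\<close> is not zero then \<open>\<bar>v\<bar>\<close> attains a positive maximum. At a maximum point \<open>z\<close>
  the equation gives \<open>A * \<bar>v z\<bar> \<le> B * \<bar>v (z - c * h)\<bar>\<close>, so \<open>z - c * h\<close> is a maximum point too. Iterating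
  contradicts the decay at \<open>- \<infinity>\<close>. The case \<open>A = B\<close> (\<open>lam\<close> a characteristic root) is included.
\<close>

section \<open>Second-derivative test at a global maximum\<close>

text \<open>If \<open>D\<close> were positive, \<open>f1\<close> would be positive just to the right
  of its zero \<open>x0\<close>, so \<open>f\<close> would rise above its maximum there.\<close>

lemma second_derivative_nonpos_at_max:
  fixes f f1 :: "real \<Rightarrow> real"
  assumes d1: "\<And>x. (f has_real_derivative f1 x) (at x)"
    and d2: "(f1 has_real_derivative D) (at x0)"
    and max: "\<And>x. f x \<le> f x0"
  shows "f1 x0 = 0" and "D \<le> 0"
proof -
  show z: "f1 x0 = 0"
    by (rule DERIV_local_max[OF d1, of 1]) (auto simp: max)
  show "D \<le> 0"
  proof (rule ccontr)
    assume "\<not> D \<le> 0"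
    then obtain r where r: "r > 0" "\<And>e. 0 < e \<Longrightarrow> e < r \<Longrightarrow> f1 x0 < f1 (x0 + e)"
      using DERIV_pos_inc_right[OF d2] by auto
    have "f x0 < f (x0 + r / 2)"
    proof (rule DERIV_pos_imp_increasing_open[where f = f])
      fix x assume x: "x0 < x" "x < x0 + r / 2"
      then have "f1 x > 0"
        using r(2)[of "x - x0"] r(1) z by auto
      then show "\<exists>y. (f has_real_derivative y) (at x) \<and> y > 0"
        using d1 by blast
    next
      show "continuous_on {x0..x0 + r / 2} f"
        using d1 by (meson DERIV_isCont continuous_at_imp_continuous_on)
    qed (use r in auto)
    with max[of "x0 + r / 2"] show False by simp
  qed
qed

section \<open>Decay of integrable solutions at both ends\<close>

text \<open>Dominated convergence with majorant \<open>\<bar>v\<bar>\<close>: each fixed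
  \<open>s\<close> eventually leaves \<open>S z\<close>, so the integrand tends to 0
  pointwise.\<close>

lemma integral_escaping_sets_tendsto_0:
  fixes v :: "real \<Rightarrow> real"
  assumes int: "integrable lborel v"
    and S: "\<And>z. S z \<in> sets borel" "\<And>s. \<forall>\<^sub>F z in at_top. s \<notin> S z"
  shows "((\<lambda>z :: real. LINT s|lborel. indicator (S z) s * \<bar>v s\<bar>) \<longlongrightarrow> 0) at_top"
proof -
  note [measurable] = borel_measurable_integrable[OF int] S(1)
  have "((\<lambda>z. LINT s|lborel. indicator (S z) s * \<bar>v s\<bar>) \<longlongrightarrow> (LINT s|(lborel :: real measure). (0::real))) at_top"
  proof (rule integral_dominated_convergence_at_top[where w = "\<lambda>s. \<bar>v s\<bar>"])
    show "AE s in lborel. ((\<lambda>z. indicator (S z) s * \<bar>v s\<bar>) \<longlongrightarrow> 0) at_top"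
      proof (rule AE_I2)
      fix s
      show "((\<lambda>z. indicator (S z) s * \<bar>v s\<bar>) \<longlongrightarrow> 0) at_top"
        by (rule tendsto_eventually[OF eventually_mono[OF S(2)[of s]]]) simp
    qed
  qed (use int in \<open>auto simp: indicator_def\<close>)
  then show ?thesis by simp
qed

lemma window_integral_tendsto_0:
  fixes v :: "real \<Rightarrow> real"
  assumes "integrable lborel v"
  shows "((\<lambda>z. LINT s|lborel. indicator {z - r..z} s * \<bar>v s\<bar>) \<longlongrightarrow> 0) at_top"
    and "((\<lambda>z. LINT s|lborel. indicator {z - r..z} s * \<bar>v s\<bar>) \<longlongrightarrow> 0) at_bot"
proof -
  have "\<forall>\<^sub>F z in at_top. s \<notin> {z - r..z}" for s
    using eventually_gt_at_top[of "s + r"] by eventually_elim simp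
  then show "((\<lambda>z. LINT s|lborel. indicator {z - r..z} s * \<bar>v s\<bar>) \<longlongrightarrow> 0) at_top"
    by (intro integral_escaping_sets_tendsto_0[OF assms]) auto
  \<comment> \<open>The limit at minus infinity is reduced to one at plus infinity by reflecting
    \<open>z\<close> to \<open>- z\<close>.\<close>
  have "\<forall>\<^sub>F z in at_top. s \<notin> {- z - r..- z}" for s
    using eventually_gt_at_top[of "- s"] by eventually_elim simp
  then have "((\<lambda>z. LINT s|lborel. indicator {- z - r..- z} s * \<bar>v s\<bar>) \<longlongrightarrow> 0) at_top"
    by (intro integral_escaping_sets_tendsto_0[OF assms]) auto
  then show "((\<lambda>z. LINT s|lborel. indicator {z - r..z} s * \<bar>v s\<bar>) \<longlongrightarrow> 0) at_bot"
    by (simp add: filterlim_at_bot_mirror)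
qed

text \<open>
  The bound makes \<open>v1 + q v\<close> globally bounded; integrating it over a window of width \<open>r\<close> then
  controls \<open>v z\<close> by the mass of \<open>v\<close> on the window plus a term of order \<open>r\<close>.
\<close>

lemma integrable_solution_tendsto_0:
  fixes v v1 v2 :: "real \<Rightarrow> real"
  assumes d1: "\<And>x. (v has_real_derivative v1 x) (at x)"
    and d2: "\<And>x. (v1 has_real_derivative v2 x) (at x)"
    and bd: "\<And>x. \<bar>v2 x + q * v1 x\<bar> \<le> A * \<bar>v x\<bar> + B * \<bar>v (x - \<tau>)\<bar>"
    and AB: "A \<ge> 0" "B \<ge> 0"
    and int: "integrable lborel v"
  shows "(v \<longlongrightarrow> 0) at_top" and "(v \<longlongrightarrow> 0) at_bot"
proof -
  have cont: "continuous_on S v" for S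
    using d1 by (meson DERIV_isCont continuous_at_imp_continuous_on)
  have int_shift: "integrable lborel (\<lambda>x. v (x - \<tau>))"
    using lborel_integrable_real_affine[OF int, of 1 "-\<tau>"] by (simp add: algebra_simps)
  define w where "w = (\<lambda>x. A * \<bar>v x\<bar> + B * \<bar>v (x - \<tau>)\<bar>)"
  have w_on: "w integrable_on UNIV"
    using int int_shift unfolding w_def by (intro integrable_on_lborel) auto
  have w_nn: "w x \<ge> 0" for x using AB by (auto simp: w_def)
  have w_ab: "w integrable_on {a..b}" for a b
    using w_on integrable_on_subinterval[of w UNIV a b] by simp
  \<comment> \<open>The derivative of \<open>f\<close> is exactly the quantity bounded by the
    integrable \<open>w\<close>, so the total mass of \<open>w\<close> bounds every increment of
    \<open>f\<close>.\<close>
  define f where "f = (\<lambda>x. v1 x + q * v x)"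
  have df: "(f has_real_derivative v2 x + q * v1 x) (at x)" for x
    unfolding f_def by (auto intro!: derivative_eq_intros d1 d2)
  have f_inc: "\<bar>f b - f a\<bar> \<le> integral UNIV w" if "a \<le> b" for a b
  proof -
    have hi: "((\<lambda>x. v2 x + q * v1 x) has_integral (f b - f a)) {a..b}"
      by (rule fundamental_theorem_of_calculus[OF that])
         (auto simp flip: has_real_derivative_iff_has_vector_derivative intro: has_field_derivative_at_within df)
    have "\<bar>f b - f a\<bar> = norm (integral {a..b} (\<lambda>x. v2 x + q * v1 x))"
      using integral_unique[OF hi] by simp
    also have "\<dots> \<le> integral {a..b} w"
      using hi bd w_ab by (intro integral_norm_bound_integral) (auto simp: w_def)
    also have "\<dots> \<le> integral UNIV w"
      using w_on w_ab w_nn by (intro integral_subset_le) auto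
    finally show ?thesis .
  qed
  define F where "F = \<bar>f 0\<bar> + integral UNIV w"
  have F: "\<bar>f x\<bar> \<le> F" for x
    using f_inc[of 0 x] f_inc[of x 0] unfolding F_def by (cases "x \<ge> 0") auto
  have F0: "F \<ge> 0" using F[of 0] by simp
  define J where "J r z = (LINT s|lborel. indicator {z - r..z} s * \<bar>v s\<bar>)" for r z
  have J: "((\<lambda>s. \<bar>v s\<bar>) has_integral J r z) {z - r..z}" for r z
  proof -
    have "set_integrable lborel {z - r..z} (\<lambda>s. \<bar>v s\<bar>)"
      unfolding set_integrable_def using int by (intro integrable_mult_indicator) auto
    from set_borel_integral_eq_integral[OF this] show ?thesis
      by (simp add: J_def set_lebesgue_integral_def has_integral_iff)
  qed
  have est: "\<bar>v z\<bar> \<le> J r z / r + F * r + \<bar>q\<bar> * J r z" if r: "r > 0" for r z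
  proof -
    \<comment> \<open>Integrate \<open>v1 = f - q * v\<close> from \<open>s\<close> to
      \<open>z\<close>; the part with \<open>f\<close> costs at most \<open>F\<close> times the
      length.\<close>
    have "\<bar>v z\<bar> \<le> \<bar>v s\<bar> + (F * r + \<bar>q\<bar> * J r z)" if s: "s \<in> {z - r..z}" for s
    proof -
      have hi: "(v1 has_integral (v z - v s)) {s..z}"
        using s
        by (intro fundamental_theorem_of_calculus)
           (auto simp flip: has_real_derivative_iff_has_vector_derivative intro: has_field_derivative_at_within d1)
      have io: "(\<lambda>x. \<bar>v x\<bar>) integrable_on {s..z}"
        by (intro integrable_continuous_interval continuous_intros cont)
      have "\<bar>v z - v s\<bar> = norm (integral {s..z} v1)"
        using integral_unique[OF hi] by simp
      also have "\<dots> \<le> integral {s..z} (\<lambda>x. F + \<bar>q\<bar> * \<bar>v x\<bar>)"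
      proof (rule integral_norm_bound_integral)
        show "v1 integrable_on {s..z}" using hi by blast
        show "(\<lambda>x. F + \<bar>q\<bar> * \<bar>v x\<bar>) integrable_on {s..z}"
          by (intro integrable_continuous_interval continuous_intros cont)
        fix x
        have "v1 x = f x - q * v x" by (simp add: f_def)
        then have "\<bar>v1 x\<bar> \<le> \<bar>f x\<bar> + \<bar>q * v x\<bar>" by linarith
        then show "norm (v1 x) \<le> F + \<bar>q\<bar> * \<bar>v x\<bar>"
          using F[of x] by (simp add: abs_mult)
      qed
      also have "\<dots> = F * (z - s) + \<bar>q\<bar> * integral {s..z} (\<lambda>x. \<bar>v x\<bar>)"
        using s io by (subst integral_add) (auto intro!: integrable_on_mult_right)
      also have "\<dots> \<le> F * r + \<bar>q\<bar> * J r z"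
      proof (intro add_mono mult_left_mono)
        show "integral {s..z} (\<lambda>x. \<bar>v x\<bar>) \<le> J r z"
          using integral_subset_le[OF _ io, of "{z - r..z}"] J[of r z] s
          by (auto simp: integral_unique has_integral_integrable)
      qed (use s F0 in auto)
      finally show ?thesis by linarith
    qed
    \<comment> \<open>Averaging over all \<open>s\<close> in the window replaces the uncontrolled
      value \<open>\<bar>v s\<bar>\<close> by \<open>J r z / r\<close>.\<close>
    then have "integral {z - r..z} (\<lambda>s. \<bar>v z\<bar>) \<le> integral {z - r..z} (\<lambda>s. \<bar>v s\<bar> + (F * r + \<bar>q\<bar> * J r z))"
      by (intro integral_le integrable_continuous_interval continuous_intros cont) auto
    also have "\<dots> = J r z + r * (F * r + \<bar>q\<bar> * J r z)"
      using J[of r z] r by (subst integral_add) (auto simp: integral_unique has_integral_integrable)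
    finally have "r * \<bar>v z\<bar> \<le> J r z + r * (F * r + \<bar>q\<bar> * J r z)"
      using r by simp
    then have "\<bar>v z\<bar> \<le> (J r z + r * (F * r + \<bar>q\<bar> * J r z)) / r"
      using r by (simp add: field_simps)
    then show ?thesis using r by (simp add: add_divide_distrib)
  qed
  have conv: "(v \<longlongrightarrow> 0) \<FF>" if lim: "\<And>r. (J r \<longlongrightarrow> 0) \<FF>" for \<FF>
  proof (rule tendstoI)
    fix e :: real assume e: "e > 0"
    \<comment> \<open>The width is fixed first to make \<open>F * r\<close> small; the terms with
      \<open>J\<close> then vanish in the limit. The \<open>+ 1\<close> covers
      \<open>F = 0\<close>.\<close>
    define r where "r = e / (2 * (F + 1))"
    have r: "r > 0" "F * r < e"
      using e F0 by (auto simp: r_def field_simps add_nonneg_pos)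
    have "((\<lambda>z. J r z / r + F * r + \<bar>q\<bar> * J r z) \<longlongrightarrow> 0 / r + F * r + \<bar>q\<bar> * 0) \<FF>"
      using r by (intro tendsto_intros lim) auto
    then have "\<forall>\<^sub>F z in \<FF>. J r z / r + F * r + \<bar>q\<bar> * J r z < e"
      using r by (intro order_tendstoD(2)) auto
    then show "\<forall>\<^sub>F z in \<FF>. dist (v z) 0 < e"
    proof eventually_elim
      case (elim z)
      then show ?case using est[OF r(1), of z] by simp
    qed
  qed
  show "(v \<longlongrightarrow> 0) at_top" "(v \<longlongrightarrow> 0) at_bot"
    using window_integral_tendsto_0[OF int] by (auto intro!: conv simp: J_def[abs_def])
qed

section \<open>Maximum principle with delay\<close>

text \<open>For \<open>B < A\<close> a single maximum point would already be contradictory. Equality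
  allows the maximum to persist at earlier points, so it has to be followed back to minus
  infinity.\<close>

lemma delayed_maximum_principle:
  fixes v v1 v2 G :: "real \<Rightarrow> real"
  assumes d1: "\<And>x. (v has_real_derivative v1 x) (at x)"
    and d2: "\<And>x. (v1 has_real_derivative v2 x) (at x)"
    and eq: "\<And>x. v2 x + q * v1 x = A * v x - G x"
    and G: "\<And>x. \<bar>G x\<bar> \<le> B * \<bar>v (x - \<tau>)\<bar>"
    and AB: "0 < B" "B \<le> A" and \<tau>: "\<tau> > 0"
    and lim: "(v \<longlongrightarrow> 0) at_top" "(v \<longlongrightarrow> 0) at_bot"
  shows "v x = 0"
proof (rule ccontr)
  assume x: "v x \<noteq> 0"
  then have ex: "0 < \<bar>v x\<bar>" by simp
  \<comment> \<open>Outside \<open>{R2..R1}\<close> the modulus stays below its value at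
    \<open>x\<close>, so a maximum over this compact interval is global.\<close>
  obtain R1 where R1: "\<And>z. z \<ge> R1 \<Longrightarrow> \<bar>v z\<bar> < \<bar>v x\<bar>"
    using tendstoD[OF lim(1) ex] by (auto simp: eventually_at_top_linorder)
  obtain R2 where R2: "\<And>z. z \<le> R2 \<Longrightarrow> \<bar>v z\<bar> < \<bar>v x\<bar>"
    using tendstoD[OF lim(2) ex] by (auto simp: eventually_at_bot_linorder)
  have xin: "x \<in> {R2..R1}"
    using R1[of x] R2[of x] by force
  have "continuous_on {R2..R1} (\<lambda>z. \<bar>v z\<bar>)"
    using d1 by (intro continuous_intros) (meson DERIV_isCont continuous_at_imp_continuous_on)
  then obtain z0 where z0: "\<And>z. z \<in> {R2..R1} \<Longrightarrow> \<bar>v z\<bar> \<le> \<bar>v z0\<bar>"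
    using continuous_attains_sup[of "{R2..R1}" "\<lambda>z. \<bar>v z\<bar>"] xin by (metis compact_Icc empty_iff)
  define M where "M = \<bar>v z0\<bar>"
  have M: "\<bar>v z\<bar> \<le> M" for z
    using z0[of z] z0[OF xin] R1[of z] R2[of z] unfolding M_def by force
  have M0: "M > 0" using M[of x] ex by linarith
  have step: "\<bar>v (z - \<tau>)\<bar> = M" if z: "\<bar>v z\<bar> = M" for z
  proof -
    \<comment> \<open>The sign turns a maximum of \<open>\<bar>v\<bar>\<close> into one of the
      differentiable function \<open>s * v\<close>, treating positive and negative extrema
      together.\<close>
    define s where "s = sgn (v z)"
    have s: "\<bar>s\<bar> = 1" "s * v z = M"
      using z M0 by (auto simp: s_def abs_sgn_eq abs_sgn sgn_mult mult.commute)
    have mx: "s * v y \<le> s * v z" for y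
      using M[of y] s abs_ge_self[of "s * v y"] by (simp add: abs_mult)
    have "s * v1 z = 0" "s * v2 z \<le> 0"
      using second_derivative_nonpos_at_max[OF DERIV_cmult[OF d1, of s] DERIV_cmult[OF d2, of s] mx]
      by blast+
    moreover have "s * v2 z + q * (s * v1 z) = A * (s * v z) - s * G z"
      using arg_cong[OF eq[of z], of "\<lambda>t. s * t"] by (simp add: algebra_simps)
    ultimately have "A * M \<le> s * G z" using s by auto
    also have "\<dots> \<le> B * \<bar>v (z - \<tau>)\<bar>"
      using G[of z] s abs_ge_self[of "s * G z"] by (simp add: abs_mult)
    finally have "A * M \<le> B * \<bar>v (z - \<tau>)\<bar>" .
    moreover have "B * M \<le> A * M" using AB M0 by simp
    ultimately have "M \<le> \<bar>v (z - \<tau>)\<bar>" using AB by (meson mult_le_cancel_left_pos order_trans)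
    with M show ?thesis by (simp add: antisym)
  qed
  have "\<bar>v (z0 - real n * \<tau>)\<bar> = M" for n
  proof (induction n)
    case (Suc n)
    then show ?case using step[of "z0 - real n * \<tau>"] by (simp add: algebra_simps)
  qed (simp add: M_def)
  moreover obtain R where R: "\<And>z. z \<le> R \<Longrightarrow> \<bar>v z\<bar> < M"
    using tendstoD[OF lim(2) M0] by (auto simp: eventually_at_bot_linorder)
  moreover obtain n where "z0 - R \<le> real n * \<tau>"
    using \<tau> by (meson reals_Archimedean3 less_imp_le)
  ultimately show False
    by (metis add.commute diff_le_eq le_diff_eq less_irrefl)
qed

section \<open>The ordinary differential equation of a profile\<close>

lemma profile_ode:
  assumes "semi_wavefront_profile h g c \<psi>"
  obtains p1 p2 where "\<And>z. (\<psi> has_real_derivative p1 z) (at z)"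
    and "\<And>z. (p1 has_real_derivative p2 z) (at z)"
    and "\<And>z. c * p1 z = p2 z - \<psi> z + g (\<psi> (z - c * h))"
proof -
  from assms obtain ut ux uxx where u: "\<And>t x. t > 0 \<Longrightarrow>
        ((\<lambda>s. \<psi> (x + c * s)) has_real_derivative ut t x) (at t) \<and>
        ((\<lambda>y. \<psi> (y + c * t)) has_real_derivative ux t x) (at x) \<and>
        ((\<lambda>y. ux t y) has_real_derivative uxx t x) (at x) \<and>
        ut t x = uxx t x - \<psi> (x + c * t) + g (\<psi> (x + c * (t - h)))"
    unfolding semi_wavefront_profile_def solves_delayed_RD_def by blast
  \<comment> \<open>One positive time suffices: at time 1 and position \<open>z - c\<close> the
    travelling coordinate equals \<open>z\<close>.\<close>
  define p1 where "p1 = (\<lambda>z. ux 1 (z - c))"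
  define p2 where "p2 = (\<lambda>z. uxx 1 (z - c))"
  have p1: "(\<psi> has_real_derivative p1 z) (at z)" for z
    using u[of 1 "z - c"] DERIV_shift[of \<psi> "p1 z" "z - c" c] by (simp add: p1_def)
  have p2: "(p1 has_real_derivative p2 z) (at z)" for z
    using u[of 1 "z - c"] DERIV_shift[of "ux 1" "p2 z" z "-c"] by (simp add: p1_def p2_def)
  have "c * p1 z = p2 z - \<psi> z + g (\<psi> (z - c * h))" for z
  proof -
    have "((\<lambda>s. \<psi> (z - c + c * s)) has_real_derivative p1 z * c) (at 1)"
      by (rule DERIV_chain2[where f = \<psi>]) (auto intro!: derivative_eq_intros p1)
    then have "ut 1 (z - c) = c * p1 z"
      using u[of 1 "z - c"] by (auto dest: DERIV_unique simp: mult.commute)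
    then show ?thesis using u[of 1 "z - c"] by (simp add: p2_def algebra_simps)
  qed
  with p1 p2 that show ?thesis by blast
qed

section \<open>Zeros and sign of the characteristic function\<close>

lemma char_E_deriv:
  "(char_E h L c has_real_derivative (- 2 * z + c + L * (c * h) * exp (- z * c * h))) (at z)"
  unfolding char_E_def[abs_def]
  by (auto intro!: derivative_eq_intros)

lemma char_E_deriv2:
  "((\<lambda>z. - 2 * z + c + L * (c * h) * exp (- z * c * h)) has_real_derivative
      - 2 - L * (c * h)\<^sup>2 * exp (- z * c * h)) (at z)"
  by (auto intro!: derivative_eq_intros simp: power2_eq_square)

text \<open>The derivative is strictly decreasing, so it vanishes at most once, while three zeros
  would give two critical points by Rolle. Finiteness makes the \<open>Min\<close> and
  \<open>Max\<close> in \<open>lambda1\<close> and \<open>lambda2\<close> meaningful.\<close>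

lemma finite_char_E_zeros:
  assumes L: "L > 0"
  shows "finite {z. char_E h L c z = 0}"
proof (rule ccontr)
  let ?D = "\<lambda>z. - 2 * z + c + L * (c * h) * exp (- z * c * h)"
  have dec: "?D y < ?D x" if "x < y" for x y
  proof (rule DERIV_neg_imp_decreasing[OF that])
    fix z
    have "0 \<le> L * (c * h)\<^sup>2 * exp (- z * c * h)" using L by simp
    then have "- 2 - L * (c * h)\<^sup>2 * exp (- z * c * h) < 0" by linarith
    then show "\<exists>d. (?D has_real_derivative d) (at z) \<and> d < 0"
      using char_E_deriv2 by blast
  qed
  have rolle: "\<exists>z. x < z \<and> z < y \<and> ?D z = 0"
    if "x < y" "char_E h L c x = 0" "char_E h L c y = 0" for x y
    using Rolle_deriv[of x y "char_E h L c"] MVT2[OF that(1) char_E_deriv[of h L c]] that by auto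
  assume "infinite {z. char_E h L c z = 0}"
  then obtain X where X: "X \<subseteq> {z. char_E h L c z = 0}" "card X = 3" "finite X"
    using infinite_arbitrarily_large by blast
  define xs where "xs = sorted_list_of_set X"
  have xs: "sorted_wrt (<) xs" "set xs = X" "length xs = 3"
    using X by (auto simp: xs_def)
  then have "xs ! 0 < xs ! 1" "xs ! 1 < xs ! 2"
    using sorted_wrt_nth_less[of "(<)" xs] by auto
  moreover have "char_E h L c (xs ! i) = 0" if "i < 3" for i
    using X xs that nth_mem by fastforce
  ultimately obtain y z where "y < xs ! 1" "?D y = 0" "xs ! 1 < z" "?D z = 0"
    using rolle[of "xs ! 0" "xs ! 1"] rolle[of "xs ! 1" "xs ! 2"] by auto
  then show False using dec[of y z] by auto
qed

text \<open>For \<open>z \<le> 0\<close> the polynomial part is at most 1 and the exponential term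
  at least \<open>L > 1\<close>.\<close>

lemma char_E_nonneg_imp_pos:
  assumes "h > 0" "L > 1" "c > 0" "char_E h L c z \<ge> 0"
  shows "z > 0"
proof (rule ccontr)
  assume z: "\<not> z > 0"
  then have "- z * c * h \<ge> 0" using assms by (simp add: mult_nonpos_nonneg)
  then have "1 \<le> exp (- z * c * h)" by simp
  then have "L * 1 \<le> L * exp (- z * c * h)" using assms by (intro mult_left_mono) auto
  moreover have "c * z \<le> 0" using z assms by (simp add: mult_nonneg_nonpos)
  moreover have "z\<^sup>2 \<ge> 0" by simp
  ultimately show False using assms unfolding char_E_def by linarith
qed

text \<open>
  For \<open>z > 0\<close> the function \<open>char_E h L c z\<close> increases with \<open>c\<close>, so every speed above the infimum
  is admissible; the infimum itself is reached by compactness of the admissible \<open>z\<close>.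
\<close>

lemma char_E_nonneg_at_critical:
  assumes h: "h > 0" and L: "L > 1" and c: "c > 0" and crit: "c \<ge> critical_speed h L"
  shows "\<exists>z. char_E h L c z \<ge> 0"
proof -
  define C where "C = {c. c > 0 \<and> (\<exists>z0. char_E h L c z0 \<ge> 0)}"
  \<comment> \<open>The speed \<open>L\<close> with \<open>z0 = 1\<close> witnesses that the set
    under the infimum is nonempty.\<close>
  have "char_E h L L 1 \<ge> 0"
  proof -
    have "exp (- 1 * L * h) \<le> 1" using h L by simp
    then have "L * exp (- 1 * L * h) \<le> L * 1" using L by (intro mult_left_mono) auto
    then show ?thesis unfolding char_E_def by simp
  qed
  then have "L \<in> C" using L by (auto simp: C_def)
  then have ne: "C \<noteq> {}" by blast
  \<comment> \<open>The bound \<open>c + 2\<close> is independent of \<open>d\<close>: beyond it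
    \<open>c + d - z < -1\<close>, which makes the quadratic part negative. All these points lie in
    one compact interval.\<close>
  have lt: "\<exists>z. 0 \<le> z \<and> z \<le> c + 2 \<and> char_E h L (c + d) z \<ge> 0" if d: "0 < d" "d < 1" for d
  proof -
    have "Inf C < c + d" using crit d by (simp add: critical_speed_def C_def)
    then obtain c' where c': "c' \<in> C" "c' < c + d"
      using ne cInf_lessD by blast
    then obtain z where z: "char_E h L c' z \<ge> 0" "c' > 0" by (auto simp: C_def)
    have zp: "z > 0" using char_E_nonneg_imp_pos[OF h L] z by blast
    have 1: "char_E h L c' z \<le> char_E h L (c + d) z"
    proof -
      have "c' * z \<le> (c + d) * z" using c' zp by simp
      moreover have "exp (- z * (c + d) * h) \<le> exp (- z * c' * h)"
        using c' zp h by simp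
      then have "L * exp (- z * (c + d) * h) \<le> L * exp (- z * c' * h)"
        using L by simp
      ultimately show ?thesis unfolding char_E_def by linarith
    qed
    have "z \<le> c + 2"
    proof (rule ccontr)
      assume zz: "\<not> z \<le> c + 2"
      have "L * exp (- z * (c + d) * h) > 0" using L by simp
      then have "0 < z * (c + d - z) + 1"
        using 1 z unfolding char_E_def by (simp add: algebra_simps power2_eq_square)
      moreover have "z * (c + d - z) \<le> z * (-1)"
        using zz zp d by (intro mult_left_mono) auto
      ultimately show False using zz c by simp
    qed
    with 1 z zp show ?thesis by (intro exI[of _ z]) auto
  qed
  \<comment> \<open>The shift by 2 keeps the increment strictly below 1 even for
    \<open>n = 0\<close>.\<close>
  have "\<exists>z. 0 \<le> z \<and> z \<le> c + 2 \<and> char_E h L (c + 1 / real (n + 2)) z \<ge> 0" for n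
    by (rule lt) auto
  then obtain Z where Z: "\<And>n. 0 \<le> Z n" "\<And>n. Z n \<le> c + 2"
    "\<And>n. char_E h L (c + 1 / real (n + 2)) (Z n) \<ge> 0" by metis
  have "compact {0..c + 2}" by simp
  then obtain l r where l: "strict_mono r" "(Z \<circ> r) \<longlonglongrightarrow> l"
    using Z unfolding compact_def by (metis atLeastAtMost_iff)
  have "(\<lambda>n. 1 / real (n + 2)) \<longlonglongrightarrow> 0"
    using LIMSEQ_ignore_initial_segment[OF lim_1_over_n, of 2] by simp
  from LIMSEQ_subseq_LIMSEQ[OF this l(1)]
  have r0: "(\<lambda>n. 1 / real (r n + 2)) \<longlonglongrightarrow> 0" by (simp add: o_def)
  have "(\<lambda>n. char_E h L (c + 1 / real (r n + 2)) ((Z \<circ> r) n)) \<longlonglongrightarrow> char_E h L (c + 0) l"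
    unfolding char_E_def by (intro tendsto_intros l r0)
  then have "char_E h L (c + 0) l \<ge> 0"
    by (rule LIMSEQ_le_const) (use Z in auto)
  then show ?thesis by auto
qed

text \<open>A concave function lies above its chord, and the chord between two zeros is
  zero.\<close>

lemma char_E_nonneg_between_roots:
  assumes h: "h > 0" and L: "L > 1" and c: "c > 0" and crit: "c \<ge> critical_speed h L"
    and lam: "lam \<in> {lambda1 h L c..lambda2 h L c}"
  shows "char_E h L c lam \<ge> 0"
proof -
  let ?S = "{z. char_E h L c z = 0}"
  obtain z where z: "char_E h L c z \<ge> 0"
    using char_E_nonneg_at_critical[OF h L c crit] by blast
  have z0: "z > 0" using char_E_nonneg_imp_pos[OF h L c z] .
  have cont: "continuous_on S (char_E h L c)" for S
    unfolding char_E_def[abs_def] by (intro continuous_intros)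
  \<comment> \<open>The value at 0 is \<open>1 - L < 0\<close>, so a root lies between 0 and
    \<open>z\<close>.\<close>
  have "\<exists>x\<ge>0. x \<le> z \<and> char_E h L c x = 0"
    by (rule IVT') (use z z0 L cont in \<open>auto simp: char_E_def\<close>)
  then have ne: "?S \<noteq> {}" by auto
  have fin: "finite ?S" using finite_char_E_zeros L by simp
  have roots: "char_E h L c (lambda1 h L c) = 0" "char_E h L c (lambda2 h L c) = 0"
    using Min_in[OF fin ne] Max_in[OF fin ne] by (auto simp: lambda1_def lambda2_def)
  have conc: "concave_on UNIV (char_E h L c)"
  proof (rule f''_le0_imp_concave[OF _ char_E_deriv char_E_deriv2])
    fix x
    have "0 \<le> L * (c * h)\<^sup>2 * exp (- x * c * h)" using L by simp
    then show "- 2 - L * (c * h)\<^sup>2 * exp (- x * c * h) \<le> 0" by linarith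
  qed simp
  show ?thesis
  \<comment> \<open>A double root is separated because the weight \<open>t\<close> divides by the
    distance of the roots.\<close>
  proof (cases "lambda1 h L c = lambda2 h L c")
    case True
    then show ?thesis using lam roots by auto
  next
    case False
    define a where "a = lambda1 h L c"
    define b where "b = lambda2 h L c"
    have ab: "a < b" "a \<le> lam" "lam \<le> b" using False lam by (auto simp: a_def b_def)
    define t where "t = (lam - a) / (b - a)"
    have t: "0 \<le> t" "t \<le> 1" using ab by (auto simp: t_def field_simps)
    have "t * (b - a) = lam - a" using ab by (simp add: t_def)
    then have "lam = (1 - t) *\<^sub>R a + t *\<^sub>R b" by (simp add: algebra_simps)
    then show ?thesis
      using concave_onD[OF conc t, of a b] roots by (simp add: a_def b_def)
  qed
qed

section \<open>The weighted difference of two profiles\<close>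

theorem corollary4:
  fixes h Lg \<kappa> c lam :: real and g \<phi>1 \<phi>2 :: "real \<Rightarrow> real"
  assumes "h > 0"
    and "g ` {0..} \<subseteq> {0..}"
    and "Lg-lipschitz_on {0..} g" and "Lg > 1"
    and "\<kappa> > 0" and "{x \<in> {0..}. g x = x} = {0, \<kappa>}"
    and "c \<ge> critical_speed h Lg"
    and "lam \<in> {lambda1 h Lg c..lambda2 h Lg c}"
    and "semi_wavefront_profile h g c \<phi>1"
    and "semi_wavefront_profile h g c \<phi>2"
    and "integrable lborel (\<lambda>z. exp (- lam * z) * \<bar>\<phi>1 z - \<phi>2 z\<bar>)"
  shows "\<phi>1 = \<phi>2"
proof -
  have c: "c > 0" and pos: "\<phi>1 z > 0" "\<phi>2 z > 0" for z
    using assms(9,10) by (auto simp: semi_wavefront_profile_def)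
  obtain p1 p2 where p: "\<And>z. (\<phi>1 has_real_derivative p1 z) (at z)"
      "\<And>z. (p1 has_real_derivative p2 z) (at z)"
      "\<And>z. c * p1 z = p2 z - \<phi>1 z + g (\<phi>1 (z - c * h))"
    using profile_ode[OF assms(9)] by blast
  obtain r1 r2 where r: "\<And>z. (\<phi>2 has_real_derivative r1 z) (at z)"
      "\<And>z. (r1 has_real_derivative r2 z) (at z)"
      "\<And>z. c * r1 z = r2 z - \<phi>2 z + g (\<phi>2 (z - c * h))"
    using profile_ode[OF assms(10)] by blast
  define A where "A = 1 + c * lam - lam\<^sup>2"
  define B where "B = Lg * exp (- lam * c * h)"
  have AB: "0 < B" "B \<le> A"
    using char_E_nonneg_between_roots[OF assms(1,4) c assms(7,8)] \<open>Lg > 1\<close>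
    by (auto simp: A_def B_def char_E_def)
  define e where "e z = exp (- lam * z)" for z
  have e: "(e has_real_derivative - lam * e z) (at z)" for z
    unfolding e_def[abs_def] by (auto intro!: derivative_eq_intros)
  define v where "v z = e z * (\<phi>1 z - \<phi>2 z)" for z
  define v1 where "v1 z = e z * (p1 z - r1 z) - lam * v z" for z
  define v2 where "v2 z = e z * (p2 z - r2 z) - lam * e z * (p1 z - r1 z) - lam * v1 z" for z
  define G where "G z = e z * (g (\<phi>1 (z - c * h)) - g (\<phi>2 (z - c * h)))" for z
  have d1: "(v has_real_derivative v1 z) (at z)" for z
    unfolding v_def[abs_def] v1_def by (auto intro!: derivative_eq_intros e p r simp: algebra_simps)
  have d2: "(v1 has_real_derivative v2 z) (at z)" for z
    unfolding v1_def[abs_def] v2_def by (auto intro!: derivative_eq_intros e p r d1 simp: algebra_simps v1_def)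
  have eq: "v2 z + (2 * lam - c) * v1 z = A * v z - G z" for z
  proof -
    have 1: "p2 z = c * p1 z + \<phi>1 z - g (\<phi>1 (z - c * h))"
         "r2 z = c * r1 z + \<phi>2 z - g (\<phi>2 (z - c * h))"
      using p(3)[of z] r(3)[of z] by auto
    show ?thesis
      unfolding v2_def v1_def v_def G_def A_def 1 by (simp add: algebra_simps power2_eq_square)
  qed
  have G: "\<bar>G z\<bar> \<le> B * \<bar>v (z - c * h)\<bar>" for z
  proof -
    \<comment> \<open>Positivity of the profiles puts both arguments in the half-line where
      \<open>g\<close> is Lipschitz.\<close>
    have "\<bar>g (\<phi>1 (z - c * h)) - g (\<phi>2 (z - c * h))\<bar> \<le> Lg * \<bar>\<phi>1 (z - c * h) - \<phi>2 (z - c * h)\<bar>"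
      using lipschitz_onD[OF assms(3), of "\<phi>1 (z - c * h)" "\<phi>2 (z - c * h)"] pos
      by (simp add: dist_real_def less_imp_le)
    then have "\<bar>G z\<bar> \<le> e z * (Lg * \<bar>\<phi>1 (z - c * h) - \<phi>2 (z - c * h)\<bar>)"
      by (simp add: G_def abs_mult e_def)
    \<comment> \<open>Moving the weight to the delayed point produces the exponential factor of
      \<open>B\<close>.\<close>
    also have "e z = exp (- lam * c * h) * e (z - c * h)"
      by (simp add: e_def flip: exp_add) (simp add: algebra_simps)
    finally show ?thesis by (simp add: B_def v_def abs_mult e_def mult_ac)
  qed
  have bd: "\<bar>v2 z + (2 * lam - c) * v1 z\<bar> \<le> A * \<bar>v z\<bar> + B * \<bar>v (z - c * h)\<bar>" for z
    using eq[of z] G[of z] abs_triangle_ineq4[of "A * v z" "G z"] AB by (simp add: abs_mult)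
  have cont: "continuous_on UNIV v"
    using d1 by (meson DERIV_isCont continuous_at_imp_continuous_on)
  \<comment> \<open>The assumed integrand is \<open>\<bar>v\<bar>\<close>; continuity of
    \<open>v\<close> supplies the measurability.\<close>
  have int: "integrable lborel v"
  proof (rule Bochner_Integration.integrable_bound[OF assms(11)])
    show "v \<in> borel_measurable lborel"
      using borel_measurable_continuous_onI[OF cont] by simp
  qed (simp add: v_def e_def abs_mult)
  have "v z = 0" for z
    using delayed_maximum_principle[OF d1 d2 eq G AB _
        integrable_solution_tendsto_0[OF d1 d2 bd _ _ int]] AB c assms(1) by simp
  then show ?thesis by (auto simp: v_def e_def)
qed

end
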